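(* Let $\eta\in\mathbb{C}$ satisfy $\eta^2=-3$. The balanced Pascal quartic $$X_\eta:\quad a^4+a^2e_2(u_1,\ldots,u_5)+e_4(u_1,\ldots,u_5)=0$$ in the hyperplane $L_\eta:\ u_1+\cdots+u_5=\eta a$ of $\mathbb{P}^5$ (with homogeneous coordinates $a,u_1,\dots,u_5$) is projectively equivalent to the Burkhardt quartic $$\mathcal{B}=\{\sigma_1(x_0,\dots,x_5)=\sigma_4(x_0,\dots,x_5)=0\}\subset\mathbb{P}^5.$$
   Context: We work over $\mathbb{C}$. $e_r(u_1,\dots,u_5)$ is the elementary symmetric polynomial of degree $r$ in five variables, and $\sigma_r(x_0,\dots,x_5)$ is the elementary symmetric polynomial of degree $r$ in six variables. Both $X_\eta\subset L_\eta\cong\mathbb{P}^4$ and $\mathcal{B}\subset(\sigma_1=0)\cong\mathbb{P}^4$ are quartic hypersurfaces in a projective four-space; projectively equivalent means that there is a linear isomorphism between these two four-spaces carrying the one quartic hypersurface to the other. *)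

theory Defs
  imports "HOL-Analysis.Analysis"
begin

definition esym :: "nat \<Rightarrow> ('i::finite \<Rightarrow> complex) \<Rightarrow> complex" where
  "esym r x = (\<Sum>S | card S = r. \<Prod>i\<in>S. x i)"

(* The points of the projective space P(V), as one-dimensional subspaces of V. *)
definition proj_points :: "(complex ^ 'n) set \<Rightarrow> (complex ^ 'n) set set" where
  "proj_points V = {l. vec.subspace l \<and> vec.dim l = 1 \<and> l \<subseteq> V}"

definition hypersurface ::
    "(complex ^ 'n) set \<Rightarrow> (complex ^ 'n \<Rightarrow> complex) \<Rightarrow> (complex ^ 'n) set set" where
  "hypersurface V F = {l \<in> proj_points V. \<forall>v\<in>l. F v = 0}"

(* A linear isomorphism from V to W is given by a linear map of the ambient spaces that
   restricts to a bijection from V to W; every linear map on a subspace extends to the ambient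
   space.  It has to carry the points of the first hypersurface onto the points of the second,
   and also, as it should for hypersurfaces with their scheme structure (i.e. forms up to a
   nonzero scalar), to match the defining forms up to a nonzero constant. *)
definition projectively_equivalent ::
    "(complex ^ 'm) set \<Rightarrow> (complex ^ 'm \<Rightarrow> complex) \<Rightarrow>
     (complex ^ 'n) set \<Rightarrow> (complex ^ 'n \<Rightarrow> complex) \<Rightarrow> bool" where
  "projectively_equivalent V F W G \<longleftrightarrow>
     (\<exists>f. Vector_Spaces.linear (*s) (*s) f \<and> bij_betw f V W \<and>
          (\<lambda>l. f ` l) ` hypersurface V F = hypersurface W G \<and>
          (\<exists>c. c \<noteq> 0 \<and> (\<forall>v\<in>V. G (f v) = c * F v)))"

(* Homogeneous coordinates (a, u_1, ..., u_5) are indexed by the six-element type 5 option: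
   a is the coordinate None and the u_i are the coordinates Some i. *)
definition pascal_hyperplane :: "complex \<Rightarrow> (complex ^ 5 option) set" where
  "pascal_hyperplane \<eta> = {v. (\<Sum>i\<in>UNIV. v $ Some i) = \<eta> * v $ None}"

definition pascal_form :: "complex ^ 5 option \<Rightarrow> complex" where
  "pascal_form v = (let a = v $ None; u = (\<lambda>i. v $ Some i)
                    in a ^ 4 + a ^ 2 * esym 2 u + esym 4 u)"

definition burkhardt_hyperplane :: "(complex ^ 6) set" where
  "burkhardt_hyperplane = {x. esym 1 (($) x) = 0}"

definition burkhardt_form :: "complex ^ 6 \<Rightarrow> complex" where
  "burkhardt_form x = esym 4 (($) x)"

end

theory Submission
  imports Defs
begin

text \<open>
  An isomorphism equivariant under the permutations of the \<open>u\<^sub>i\<close> has the shape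
  \<open>x\<^sub>i = u\<^sub>i + k a\<close>, \<open>x\<^sub>0 = m a\<close>, with \<open>m = - (\<eta> + 5 k)\<close> forced by \<open>\<sigma>\<^sub>1 = 0\<close>. The coefficient of \<open>a e\<^sub>3\<close> in
  \<open>\<sigma>\<^sub>4(x) = e\<^sub>4(u + k a) + m a e\<^sub>3(u + k a)\<close> is \<open>2 k + m\<close>, which vanishes for \<open>k = - \<eta> / 3\<close>, \<open>m = 2 \<eta> / 3\<close>.
  Then \<open>\<sigma>\<^sub>4(x) = 9 k\<^sup>4 a\<^sup>4 - 3 k\<^sup>2 a\<^sup>2 e\<^sub>2 + e\<^sub>4\<close>, and \<open>k\<^sup>2 = - 1 / 3\<close> makes this the Pascal form itself.
\<close>

lemma esym_reindex:
  fixes h :: "'j::finite \<Rightarrow> 'i::finite"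
  assumes "bij h"
  shows "esym r (\<lambda>j. x (h j)) = esym r x"
proof -
  have inj: "inj_on h S" for S using assms by (meson bij_is_inj inj_on_subset subset_UNIV)
  have "bij_betw ((`) h) {S. card S = r} {S. card S = r}"
    by (rule bij_betw_byWitness[where f' = "(`) (inv h)"])
      (use assms in \<open>auto simp: image_image bij_is_surj surj_f_inv_f bij_is_inj card_image
         inj inj_on_subset[OF bij_is_inj[OF bij_imp_bij_inv]]\<close>)
  then show ?thesis unfolding esym_def
    by (subst sum.reindex_bij_betw[symmetric]) (auto simp: prod.reindex[OF inj])
qed

text \<open>Sorts the subsets by whether they contain \<open>None\<close>: those that do not are
  images under \<open>Some\<close> of subsets of the same size, and those that do arise by adding
  \<open>None\<close> to a set with one element fewer.\<close>

lemma esym_Suc_option: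
  fixes x :: "'i::finite option \<Rightarrow> complex"
  shows "esym (Suc r) x = esym (Suc r) (\<lambda>i. x (Some i)) + x None * esym r (\<lambda>i. x (Some i))"
proof -
  let ?A = "(`) Some ` {S :: 'i set. card S = Suc r}"
  let ?B = "(\<lambda>S. insert None (Some ` S)) ` {S :: 'i set. card S = r}"
  have inj_A: "inj_on ((`) Some) {S :: 'i set. card S = Suc r}"
    by (simp add: inj_on_def inj_image_eq_iff)
  have inj_B: "inj_on (\<lambda>S. insert None (Some ` S)) {S :: 'i set. card S = r}"
    by (rule inj_onI) (auto simp: set_eq_iff image_iff)
  have "S \<in> ?A \<union> ?B" if "card S = Suc r" for S :: "'i option set"
  proof (cases "None \<in> S")
    case True
    then have S: "S = insert None (Some ` (Some -` S))"
      using notin_range_Some by (fastforce simp: image_iff)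
    have "card S = Suc (card (Some -` S))"
      by (subst S) (simp add: card_image del: image_vimage_eq)
    with that have "card (Some -` S) = r" by simp
    with S show ?thesis by blast
  next
    case False
    then have S: "S = Some ` (Some -` S)"
      by (auto simp: image_iff) (metis not_None_eq)
    have "card S = card (Some -` S)"
      using S card_image[of Some "Some -` S"] by simp
    with that have "card (Some -` S) = Suc r" by simp
    with S show ?thesis by blast
  qed
  then have split: "{S :: 'i option set. card S = Suc r} = ?A \<union> ?B"
    by (auto simp: card_image)
  have "esym (Suc r) x = (\<Sum>S\<in>?A. \<Prod>i\<in>S. x i) + (\<Sum>S\<in>?B. \<Prod>i\<in>S. x i)"
    unfolding esym_def split by (rule sum.union_disjoint) auto
  then show ?thesis
    by (simp add: esym_def sum.reindex[OF inj_A] sum.reindex[OF inj_B] prod.reindex sum_distrib_left)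
qed

text \<open>Removing \<open>T\<close> matches these supersets with the subsets of the complement of
  \<open>T\<close> of size \<open>r - card T\<close>.\<close>

lemma card_supersets:
  fixes T :: "'i::finite set"
  assumes "card T \<le> r"
  shows "card {S. T \<subseteq> S \<and> card S = r} = (CARD('i) - card T) choose (r - card T)"
proof -
  have "card (T \<union> U) = r" if "U \<subseteq> - T" "card U = r - card T" for U
    using that assms by (subst card_Un_disjoint) auto
  then have "bij_betw ((\<union>) T) {U. U \<subseteq> - T \<and> card U = r - card T} {S. T \<subseteq> S \<and> card S = r}"
    by (intro bij_betw_byWitness[where f' = "\<lambda>S. S - T"])
      (use assms in \<open>auto simp: card_Diff_subset finite_subset\<close>)
  then show ?thesis
    using bij_betw_same_card n_subsets[of "- T" "r - card T"]
    by (fastforce simp: Compl_eq_Diff_UNIV card_Diff_subset)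
qed

text \<open>Expanding each product over \<open>S\<close> gives one term for every \<open>T\<close>
  inside \<open>S\<close>. After exchanging the sums, the term of \<open>T\<close> is counted once
  per superset of size \<open>r\<close>, and grouping by \<open>card T\<close> produces the
  \<open>esym k u\<close>.\<close>

lemma esym_shift:
  fixes u :: "'i::finite \<Rightarrow> complex"
  shows "esym r (\<lambda>i. u i + t) =
    (\<Sum>k\<le>r. of_nat ((CARD('i) - k) choose (r - k)) * t ^ (r - k) * esym k u)"
proof -
  have "esym r (\<lambda>i. u i + t) = (\<Sum>S | card S = r. \<Sum>T\<in>Pow S. prod u T * t ^ (r - card T))"
    unfolding esym_def by (rule sum.cong) (auto simp: prod_add card_Diff_subset intro!: sum.cong)
  \<comment> \<open>The bound \<open>card T \<le> r\<close> follows from the inclusion; stating it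
    gives \<open>T\<close> a range independent of \<open>S\<close>, as the exchange of sums
    requires.\<close>
  also have "\<dots> = (\<Sum>S | card S = r. \<Sum>T | card T \<le> r \<and> T \<subseteq> S. prod u T * t ^ (r - card T))"
    by (intro sum.cong) (auto simp: card_mono)
  also have "\<dots> = (\<Sum>T | card T \<le> r. \<Sum>S | card S = r \<and> T \<subseteq> S. prod u T * t ^ (r - card T))"
    by (subst sum.swap_restrict[of "{S. card S = r}" "{T. card T \<le> r}" _ "\<lambda>S T. T \<subseteq> S",
          simplified, symmetric]) auto
  also have "\<dots> = (\<Sum>T | card T \<le> r.
      of_nat ((CARD('i) - card T) choose (r - card T)) * t ^ (r - card T) * prod u T)"
    by (intro sum.cong) (auto simp: card_supersets conj_commute)
  also have "\<dots> = (\<Sum>k\<le>r. \<Sum>T | T \<in> {T. card T \<le> r} \<and> card T = k.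
      of_nat ((CARD('i) - card T) choose (r - card T)) * t ^ (r - card T) * prod u T)"
    by (rule sum.group[symmetric]) auto
  also have "\<dots> = (\<Sum>k\<le>r. of_nat ((CARD('i) - k) choose (r - k)) * t ^ (r - k) * esym k u)"
    unfolding esym_def sum_distrib_left by (intro sum.cong) auto
  finally show ?thesis .
qed

lemma esym_0 [simp]: "esym 0 x = 1"
  by (simp add: esym_def)

lemma esym_Suc_0:
  fixes x :: "'i::finite \<Rightarrow> complex"
  shows "esym (Suc 0) x = sum x UNIV"
proof -
  have "{S :: 'i set. card S = Suc 0} = range (\<lambda>i. {i})" by (auto simp: card_1_singleton_iff)
  then show ?thesis by (simp add: esym_def sum.reindex)
qed

text \<open>A linear bijection of the ambient spaces preserves dimensions of subspaces, and each
  line in \<open>W\<close> is the image of its preimage. As \<open>c\<close> is nonzero, the two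
  forms vanish at corresponding points.\<close>

lemma projectively_equivalentI:
  fixes f :: "complex ^ 'm \<Rightarrow> complex ^ 'n"
  assumes lin: "Vector_Spaces.linear (*s) (*s) f" and "bij f" and V: "\<And>v. f v \<in> W \<longleftrightarrow> v \<in> V"
    and c: "c \<noteq> 0" and G: "\<And>v. v \<in> V \<Longrightarrow> G (f v) = c * F v"
  shows "projectively_equivalent V F W G"
proof -
  have inj: "inj_on f S" for S
    using \<open>bij f\<close> by (meson bij_is_inj inj_on_subset subset_UNIV)
  have img: "f ` (f -` l) = l" for l
    using \<open>bij f\<close> by (simp add: bij_is_surj surj_image_vimage_eq)
  have dim: "vec.dim (f ` l) = vec.dim l" for l
    using vec.dim_image_eq[OF lin inj] .
  have "f ` V = W" using V img[of W] by (auto simp: vimage_def)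
  then have bij: "bij_betw f V W" using inj by (simp add: bij_betw_def)
  have *: "f ` l \<in> hypersurface W G \<longleftrightarrow> l \<in> hypersurface V F" if "vec.subspace l" for l
  proof -
    have "G (f v) = 0 \<longleftrightarrow> F v = 0" if "v \<in> V" for v using c G[OF that] by simp
    with that V show ?thesis
      by (auto simp: hypersurface_def proj_points_def dim subset_iff vec.linear_subspace_image[OF lin])
  qed
  have "(\<lambda>l. f ` l) ` hypersurface V F = hypersurface W G"
  proof (intro subset_antisym subsetI)
    fix l assume "l \<in> (\<lambda>l. f ` l) ` hypersurface V F"
    then show "l \<in> hypersurface W G"
      using * unfolding hypersurface_def proj_points_def by blast
  next
    fix l assume l: "l \<in> hypersurface W G"
    then have "vec.subspace (f -` l)"
      by (intro vec.linear_subspace_vimage[OF lin]) (auto simp: hypersurface_def proj_points_def)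
    then show "l \<in> (\<lambda>l. f ` l) ` hypersurface V F"
      using *[of "f -` l"] l by (metis img image_eqI)
  qed
  then show ?thesis
    unfolding projectively_equivalent_def using lin bij c G by blast
qed

lemma burkhardt_form_eq_pascal_form:
  fixes u :: "5 \<Rightarrow> complex"
  assumes u: "sum u UNIV = \<eta> * a" and \<eta>: "\<eta> ^ 2 = -3"
  shows "esym 4 (case_option (2 * \<eta> / 3 * a) (\<lambda>i. u i - \<eta> / 3 * a)) =
    a ^ 4 + a ^ 2 * esym 2 u + esym 4 u"
proof -
  define k where "k = - \<eta> / 3"
  have \<eta>k: "\<eta> = -3 * k" and k2: "k ^ 2 = -1/3"
    using \<eta> by (simp_all add: k_def power_divide)
  have e1: "esym (Suc 0) u = -3 * k * a"
    using u by (simp add: esym_Suc_0 \<eta>k)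
  have k4: "k ^ 4 = 1/9"
    using arg_cong[OF k2, of "\<lambda>z. z ^ 2"] by (simp add: power_divide)
  have "esym 4 (case_option (2 * \<eta> / 3 * a) (\<lambda>i. u i - \<eta> / 3 * a)) =
    esym (Suc 3) (case_option (- 2 * k * a) (\<lambda>i. u i + k * a))"
    by (simp add: \<eta>k)
  also have "\<dots> = esym 4 (\<lambda>i. u i + k * a) - 2 * k * a * esym 3 (\<lambda>i. u i + k * a)"
    by (subst esym_Suc_option) simp
  \<comment> \<open>The numerical coefficients here and for degree 4 are the binomials
    \<open>(5 - j) choose (r - j)\<close> of \<open>esym_shift\<close>.\<close>
  also have "esym 3 (\<lambda>i. u i + k * a) =
      10 * (k * a) ^ 3 + 6 * (k * a) ^ 2 * esym (Suc 0) u + 3 * (k * a) * esym 2 u + esym 3 u"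
    by (simp add: esym_shift atMost_nat_numeral binomial_fact fact_numeral)
  also have "esym 4 (\<lambda>i. u i + k * a) = 5 * (k * a) ^ 4 + 4 * (k * a) ^ 3 * esym (Suc 0) u +
      3 * (k * a) ^ 2 * esym 2 u + 2 * (k * a) * esym 3 u + esym 4 u"
    by (simp add: esym_shift atMost_nat_numeral binomial_fact fact_numeral)
  also have "5 * (k * a) ^ 4 + 4 * (k * a) ^ 3 * esym (Suc 0) u +
      3 * (k * a) ^ 2 * esym 2 u + 2 * (k * a) * esym 3 u + esym 4 u - 2 * k * a *
      (10 * (k * a) ^ 3 + 6 * (k * a) ^ 2 * esym (Suc 0) u + 3 * (k * a) * esym 2 u + esym 3 u) =
      9 * k ^ 4 * a ^ 4 - 3 * k ^ 2 * a ^ 2 * esym 2 u + esym 4 u"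
    \<comment> \<open>The \<open>esym 3 u\<close> terms cancel. With \<open>e1\<close>, the
      coefficient of \<open>k ^ 4 * a ^ 4\<close> is 5 - 12 - 20 + 36 = 9.\<close>
    unfolding e1 by algebra
  also have "\<dots> = a ^ 4 + a ^ 2 * esym 2 u + esym 4 u"
    by (simp add: k2 k4)
  finally show ?thesis .
qed

theorem theorem3p1:
  fixes \<eta> :: complex
  assumes "\<eta> ^ 2 = -3"
  shows "projectively_equivalent
           (pascal_hyperplane \<eta>) pascal_form
           burkhardt_hyperplane burkhardt_form"
proof -
  have "\<eta> \<noteq> 0" using assms by auto
  \<comment> \<open>Any labelling of the six coordinates will do, since \<open>esym\<close> is
    symmetric.\<close>
  obtain h :: "6 \<Rightarrow> 5 option" where h: "bij h"
    using finite_same_card_bij[of "UNIV :: 6 set" "UNIV :: 5 option set"] by auto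
  define x :: "complex ^ 5 option \<Rightarrow> 5 option \<Rightarrow> complex" where
    "x v = case_option (2 * \<eta> / 3 * v $ None) (\<lambda>i. v $ Some i - \<eta> / 3 * v $ None)" for v
  define f :: "complex ^ 5 option \<Rightarrow> complex ^ 6" where "f v = (\<chi> j. x v (h j))" for v
  have esym_f: "esym r (($) (f v)) = esym r (x v)" for r v
    using esym_reindex[OF h, of r "x v"] by (simp add: f_def esym_def)
  show ?thesis
  proof (rule projectively_equivalentI)
    show "Vector_Spaces.linear (*s) (*s) f"
      by unfold_locales (auto simp: f_def x_def vec_eq_iff algebra_simps split: option.split)
    show "bij f"
    proof (rule bijI)
      show "inj f"
      proof (rule injI)
        fix v w assume "f v = f w"
        then have "x v (h j) = x w (h j)" for j by (simp add: f_def vec_eq_iff)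
        then have x: "x v i = x w i" for i using h by (metis bij_pointE)
        have "v $ None = w $ None" using x[of None] \<open>\<eta> \<noteq> 0\<close> by (simp add: x_def)
        then have "v $ i = w $ i" for i
          using x[of i] by (cases i) (auto simp: x_def)
        then show "v = w" by (simp add: vec_eq_iff)
      qed
      show "surj f"
      proof (rule surjI)
        fix y :: "complex ^ 6"
        let ?y = "\<lambda>i. y $ inv h i"
        \<comment> \<open>The witness solves \<open>2 * \<eta> / 3 * a = ?y None\<close> for
          \<open>a\<close>; then \<open>\<eta> / 3 * a\<close> is \<open>?y None / 2\<close>, which
          is added back to recover the \<open>u\<close> coordinates.\<close>
        show "f (\<chi> i. case i of None \<Rightarrow> 3 / (2 * \<eta>) * ?y None | Some i \<Rightarrow> ?y (Some i) + ?y None / 2) = y"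
          using h \<open>\<eta> \<noteq> 0\<close> by (auto simp: f_def x_def vec_eq_iff bij_is_inj split: option.split)
            (metis bij_is_inj inv_f_f)+
      qed
    qed
    \<comment> \<open>The \<open>a\<close> terms in the sum of the new coordinates have total
      coefficient \<open>2 * \<eta> / 3 - 5 * \<eta> / 3 = - \<eta>\<close>.\<close>
    show "f v \<in> burkhardt_hyperplane \<longleftrightarrow> v \<in> pascal_hyperplane \<eta>" for v
      using esym_f[of "Suc 0" v]
      by (auto simp: burkhardt_hyperplane_def pascal_hyperplane_def esym_Suc_0 x_def
          UNIV_option_conv sum.reindex sum_subtractf algebra_simps)
    show "burkhardt_form (f v) = 1 * pascal_form v" if "v \<in> pascal_hyperplane \<eta>" for v
      using that assms burkhardt_form_eq_pascal_form[of "\<lambda>i. v $ Some i" \<eta> "v $ None"]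
      by (simp add: burkhardt_form_def pascal_form_def pascal_hyperplane_def esym_f x_def Let_def)
  qed simp
qed

end
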